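(* Let $X=(X,\varepsilon(X))$ be an exterior space whose underlying topological space is locally path-connected, connected and Hausdorff, and suppose that $\varepsilon(X)\subset \varepsilon^{\mathbf c}(X)$, i.e. the complement of every exterior open subset is a (closed) compact subset of $X$. If for every $x\in X\setminus L(X)$ there is a closed neighbourhood $F$ of $x$ such that $X\setminus F\in\varepsilon(X)$, then $\check C_0(X)$ is a Hausdorff compact space and $L(X)$ is a closed subspace of $X$.
   Context: Exterior spaces: an exterior space is a topological space $X$ together with a nonempty family $\varepsilon(X)$ of open subsets of $X$ (an externology; its members are called exterior open subsets) that is closed under finite intersections and such that if $E\in\varepsilon(X)$, $U$ is open and $E\subset U$, then $U\in\varepsilon(X)$. $\varepsilon^{\mathbf c}(X)$ denotes the cocompact externology: the family of complements of closed compact subsets of $X$. Limit and end spaces: for a space $Y$, $\pi_0(Y)$ is the set of path-components of $Y$ with the quotient topology of the canonical map $q_0\colon Y\to\pi_0(Y)$. For an exterior space $X$, $L(X)=\bigcap_{E\in\varepsilon(X)}E$ with the subspace topology, and $\check\pi_0(X)=\lim_{E\in\varepsilon(X)}\pi_0(E)$ with the inverse limit topology; $\eta_{0,E}\colon\check\pi_0(X)\to\pi_0(E)$ are the projections. The map $e_0\colon L(X)\to\check\pi_0(X)$ sends $x$ to the family of path-components of $x$ in $E$, $E\in\varepsilon(X)$. Completion: the underlying set of $\check C_0(X)$ is the push-out $X\cup_{L(X)}\check\pi_0(X)$ of the inclusion $L(X)\to X$ and $e_0$, with canonical maps $p_0\colon X\to\check C_0(X)$ and $\operatorname{in}_0\colon\check\pi_0(X)\to\check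 C_0(X)$. A subset $W$ is open in $\check C_0(X)$ iff (i) $p_0^{-1}(W)$ is open in $X$ and $\operatorname{in}_0^{-1}(W)$ is open in $\check\pi_0(X)$, and (ii) for each $a\in\operatorname{in}_0^{-1}(W)$ there are $E\in\varepsilon(X)$ and an open subset $G$ of $\pi_0(E)$ such that $a\in\eta_{0,E}^{-1}(G)\subset\operatorname{in}_0^{-1}(W)$ and $q_0^{-1}(G)\subset p_0^{-1}(W)$ (with $q_0\colon E\to\pi_0(E)$). *)

theory Defs
  imports "HOL-Analysis.Analysis"
begin

section \<open>Exterior spaces\<close>

text \<open>
  The intersection of no exterior open sets, the whole space, is exterior open by non-emptiness
  and the last clause, so that closure under binary intersections suffices.
\<close>

definition exterior_space :: "'a topology \<Rightarrow> 'a set set \<Rightarrow> bool" where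
  "exterior_space X \<epsilon> \<longleftrightarrow>
     \<epsilon> \<noteq> {} \<and> (\<forall>E\<in>\<epsilon>. openin X E) \<and>
     (\<forall>E\<in>\<epsilon>. \<forall>E'\<in>\<epsilon>. E \<inter> E' \<in> \<epsilon>) \<and>
     (\<forall>E\<in>\<epsilon>. \<forall>U. openin X U \<and> E \<subseteq> U \<longrightarrow> U \<in> \<epsilon>)"

definition cocompact_externology :: "'a topology \<Rightarrow> 'a set set" where
  "cocompact_externology X = {topspace X - K |K. closedin X K \<and> compactin X K}"

definition limit_space :: "'a topology \<Rightarrow> 'a set set \<Rightarrow> 'a topology" where
  "limit_space X \<epsilon> = subtopology X (\<Inter>\<epsilon>)"


section \<open>The space of path-components\<close>

abbreviation q0 :: "'a topology \<Rightarrow> 'a \<Rightarrow> 'a set" where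
  "q0 Y \<equiv> path_component_of_set Y"

definition pi0 :: "'a topology \<Rightarrow> 'a set topology" where
  "pi0 Y = topology (\<lambda>G. G \<subseteq> path_components_of Y \<and> openin Y {y \<in> topspace Y. q0 Y y \<in> G})"

lemma openin_pi0:
  "openin (pi0 Y) G \<longleftrightarrow> G \<subseteq> path_components_of Y \<and> openin Y {y \<in> topspace Y. q0 Y y \<in> G}"
proof -
  have "istopology (\<lambda>G. G \<subseteq> path_components_of Y \<and> openin Y {y \<in> topspace Y. q0 Y y \<in> G})"
    (is "istopology ?P")
    unfolding istopology_def
  proof (intro conjI allI impI)
    fix S T assume S: "?P S" and T: "?P T"
    show "S \<inter> T \<subseteq> path_components_of Y" using S by blast
    have "{y \<in> topspace Y. q0 Y y \<in> S \<inter> T}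
        = {y \<in> topspace Y. q0 Y y \<in> S} \<inter> {y \<in> topspace Y. q0 Y y \<in> T}" by blast
    then show "openin Y {y \<in> topspace Y. q0 Y y \<in> S \<inter> T}" using S T by auto
  next
    fix \<K> assume K: "\<forall>K\<in>\<K>. ?P K"
    show "\<Union>\<K> \<subseteq> path_components_of Y" using K by blast
    have "{y \<in> topspace Y. q0 Y y \<in> \<Union>\<K>} = (\<Union>K\<in>\<K>. {y \<in> topspace Y. q0 Y y \<in> K})" by blast
    then show "openin Y {y \<in> topspace Y. q0 Y y \<in> \<Union>\<K>}" using K by auto
  qed
  then show ?thesis by (simp add: pi0_def)
qed

lemma topspace_pi0 [simp]: "topspace (pi0 Y) = path_components_of Y"
proof -
  have "{y \<in> topspace Y. q0 Y y \<in> path_components_of Y} = topspace Y"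
    by (auto simp: path_component_in_path_components_of)
  then have "openin (pi0 Y) (path_components_of Y)" by (simp add: openin_pi0)
  then show ?thesis
    by (metis openin_pi0 openin_subset openin_topspace subset_antisym)
qed

lemma quotient_map_q0: "quotient_map Y (pi0 Y) (q0 Y)"
  by (auto simp: quotient_map_def path_components_of_def openin_pi0)

text \<open>
  The map induced on path-components by the inclusion of a space into \<open>Y\<close>.
\<close>

definition pi0_incl :: "'a topology \<Rightarrow> 'a set \<Rightarrow> 'a set" where
  "pi0_incl Y C = (THE D. D \<in> path_components_of Y \<and> C \<subseteq> D)"

lemma pi0_incl_q0:
  assumes "A \<subseteq> B" and "x \<in> topspace (subtopology X A)"
  shows "pi0_incl (subtopology X B) (q0 (subtopology X A) x) = q0 (subtopology X B) x"
  unfolding pi0_incl_def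
proof (rule the_equality)
  have xB: "x \<in> topspace (subtopology X B)" using assms by auto
  have "q0 (subtopology X A) x \<subseteq> q0 (subtopology X B) x"
    using path_component_of_mono[OF _ assms(1)] by blast
  then show "q0 (subtopology X B) x \<in> path_components_of (subtopology X B) \<and>
      q0 (subtopology X A) x \<subseteq> q0 (subtopology X B) x"
    using xB by (simp add: path_component_in_path_components_of)
next
  fix D assume D: "D \<in> path_components_of (subtopology X B) \<and> q0 (subtopology X A) x \<subseteq> D"
  have "x \<in> q0 (subtopology X A) x" using assms(2) by (simp add: path_component_of_refl)
  with D have "x \<in> D" by blast
  with D obtain y where "D = q0 (subtopology X B) y" "x \<in> q0 (subtopology X B) y"
    by (auto simp: path_components_of_def)
  then show "D = q0 (subtopology X B) x"
    by (metis mem_Collect_eq path_component_of_equiv)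
qed


section \<open>The end space\<close>

text \<open>
  The index set \<open>\<epsilon>\<close> is directed by reverse inclusion; the projection to \<open>\<pi>\<^sub>0(E)\<close> is \<open>\<lambda>a. a E\<close>.
\<close>

definition end_space :: "'a topology \<Rightarrow> 'a set set \<Rightarrow> ('a set \<Rightarrow> 'a set) topology" where
  "end_space X \<epsilon> =
     subtopology (product_topology (\<lambda>E. pi0 (subtopology X E)) \<epsilon>)
       {a. \<forall>E\<in>\<epsilon>. \<forall>E'\<in>\<epsilon>. E \<subseteq> E' \<longrightarrow> pi0_incl (subtopology X E') (a E) = a E'}"

lemma topspace_end_space:
  "topspace (end_space X \<epsilon>) =
     {a \<in> PiE \<epsilon> (\<lambda>E. path_components_of (subtopology X E)).
        \<forall>E\<in>\<epsilon>. \<forall>E'\<in>\<epsilon>. E \<subseteq> E' \<longrightarrow> pi0_incl (subtopology X E') (a E) = a E'}"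
  by (auto simp: end_space_def)

definition e0 :: "'a topology \<Rightarrow> 'a set set \<Rightarrow> 'a \<Rightarrow> ('a set \<Rightarrow> 'a set)" where
  "e0 X \<epsilon> x = (\<lambda>E\<in>\<epsilon>. q0 (subtopology X E) x)"

lemma e0_in_end_space:
  assumes "exterior_space X \<epsilon>" and "x \<in> topspace (limit_space X \<epsilon>)"
  shows "e0 X \<epsilon> x \<in> topspace (end_space X \<epsilon>)"
proof -
  have x: "x \<in> topspace (subtopology X E)" if "E \<in> \<epsilon>" for E
    using assms that by (auto simp: limit_space_def)
  show ?thesis
    using x pi0_incl_q0[of _ _ x X]
    by (auto simp: topspace_end_space e0_def path_component_in_path_components_of
             simp del: topspace_subtopology)
qed


section \<open>The completion\<close>

text \<open>
  The push-out of \<open>f\<close> and \<open>g\<close>, defined on \<open>Z\<close>, is the quotient of the disjoint union of their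
  codomains by the equivalence relation generated by \<open>f z \<sim> g z\<close>.
\<close>

definition pushout_rel :: "'z set \<Rightarrow> ('z \<Rightarrow> 'a) \<Rightarrow> ('z \<Rightarrow> 'b) \<Rightarrow> ('a + 'b) rel" where
  "pushout_rel Z f g = {(s, t). equivclp (\<lambda>s t. \<exists>z\<in>Z. s = Inl (f z) \<and> t = Inr (g z)) s t}"

abbreviation completion_rel ::
    "'a topology \<Rightarrow> 'a set set \<Rightarrow> ('a + ('a set \<Rightarrow> 'a set)) rel" where
  "completion_rel X \<epsilon> \<equiv> pushout_rel (topspace (limit_space X \<epsilon>)) (\<lambda>x. x) (e0 X \<epsilon>)"

definition completion_set ::
    "'a topology \<Rightarrow> 'a set set \<Rightarrow> ('a + ('a set \<Rightarrow> 'a set)) set set" where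
  "completion_set X \<epsilon> = (topspace X <+> topspace (end_space X \<epsilon>)) // completion_rel X \<epsilon>"

definition p0 ::
    "'a topology \<Rightarrow> 'a set set \<Rightarrow> 'a \<Rightarrow> ('a + ('a set \<Rightarrow> 'a set)) set" where
  "p0 X \<epsilon> x = completion_rel X \<epsilon> `` {Inl x}"

definition in0 ::
    "'a topology \<Rightarrow> 'a set set \<Rightarrow> ('a set \<Rightarrow> 'a set) \<Rightarrow> ('a + ('a set \<Rightarrow> 'a set)) set" where
  "in0 X \<epsilon> a = completion_rel X \<epsilon> `` {Inr a}"

lemma completion_set_eq:
  "completion_set X \<epsilon> = p0 X \<epsilon> ` topspace X \<union> in0 X \<epsilon> ` topspace (end_space X \<epsilon>)"
  by (auto simp: completion_set_def quotient_def p0_def in0_def Plus_def)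

lemma p0_eq_in0:
  assumes "x \<in> topspace (limit_space X \<epsilon>)"
  shows "p0 X \<epsilon> x = in0 X \<epsilon> (e0 X \<epsilon> x)"
proof -
  let ?r = "\<lambda>s t. \<exists>z\<in>topspace (limit_space X \<epsilon>). s = Inl z \<and> t = Inr (e0 X \<epsilon> z)"
  have "equivclp ?r (Inl x) (Inr (e0 X \<epsilon> x))"
    using assms by (intro r_into_equivclp) auto
  then have "equivclp ?r (Inl x) t \<longleftrightarrow> equivclp ?r (Inr (e0 X \<epsilon> x)) t" for t
    by (meson equivclp_sym equivclp_trans)
  then show ?thesis by (auto simp: p0_def in0_def pushout_rel_def)
qed

definition completion_open ::
    "'a topology \<Rightarrow> 'a set set \<Rightarrow> ('a + ('a set \<Rightarrow> 'a set)) set set \<Rightarrow> bool" where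
  "completion_open X \<epsilon> W \<longleftrightarrow>
     W \<subseteq> completion_set X \<epsilon> \<and>
     openin X {x \<in> topspace X. p0 X \<epsilon> x \<in> W} \<and>
     openin (end_space X \<epsilon>) {a \<in> topspace (end_space X \<epsilon>). in0 X \<epsilon> a \<in> W} \<and>
     (\<forall>a \<in> topspace (end_space X \<epsilon>). in0 X \<epsilon> a \<in> W \<longrightarrow>
        (\<exists>E\<in>\<epsilon>. \<exists>G. openin (pi0 (subtopology X E)) G \<and>
           a E \<in> G \<and>
           (\<forall>b \<in> topspace (end_space X \<epsilon>). b E \<in> G \<longrightarrow> in0 X \<epsilon> b \<in> W) \<and>
           (\<forall>x\<in>E. q0 (subtopology X E) x \<in> G \<longrightarrow> p0 X \<epsilon> x \<in> W)))"

definition exterior_completion :: "'a topology \<Rightarrow> 'a set set \<Rightarrow> ('a + ('a set \<Rightarrow> 'a set)) set topology" where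
  "exterior_completion X \<epsilon> = topology (completion_open X \<epsilon>)"

lemma openin_pi0_vimage:
  assumes "A \<subseteq> B" and "openin (pi0 (subtopology X B)) G"
  shows "openin (pi0 (subtopology X A))
           {C \<in> path_components_of (subtopology X A). pi0_incl (subtopology X B) C \<in> G}"
proof -
  let ?P = "{C \<in> path_components_of (subtopology X A). pi0_incl (subtopology X B) C \<in> G}"
  obtain V where V: "openin X V"
      "{y \<in> topspace (subtopology X B). q0 (subtopology X B) y \<in> G} = V \<inter> B"
    using assms(2) by (auto simp: openin_pi0 openin_subtopology)
  have "y \<in> topspace (subtopology X A) \<and> q0 (subtopology X A) y \<in> ?P \<longleftrightarrow> y \<in> V \<inter> A" for y
  proof (cases "y \<in> topspace (subtopology X A)")
    case True
    then have "y \<in> A" "y \<in> topspace (subtopology X B)" using assms(1) by auto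
    moreover from this have "q0 (subtopology X B) y \<in> G \<longleftrightarrow> y \<in> V \<inter> B" using V(2) by blast
    ultimately show ?thesis
      using True assms(1) pi0_incl_q0[OF assms(1) True]
      by (simp add: path_component_in_path_components_of del: topspace_subtopology) blast
  next
    case False
    then show ?thesis using openin_subset[OF V(1)] by auto
  qed
  then have "{y \<in> topspace (subtopology X A). q0 (subtopology X A) y \<in> ?P} = V \<inter> A" by blast
  then show ?thesis
    using V(1) by (auto simp: openin_pi0 openin_subtopology)
qed

lemma istopology_completion:
  assumes "exterior_space X \<epsilon>"
  shows "istopology (completion_open X \<epsilon>)"
  unfolding istopology_def
proof (intro conjI allI impI)
  fix S T assume S: "completion_open X \<epsilon> S" and T: "completion_open X \<epsilon> T"
  have "\<exists>E\<in>\<epsilon>. \<exists>G. openin (pi0 (subtopology X E)) G \<and> a E \<in> G \<and>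
           (\<forall>b \<in> topspace (end_space X \<epsilon>). b E \<in> G \<longrightarrow> in0 X \<epsilon> b \<in> S \<inter> T) \<and>
           (\<forall>x\<in>E. q0 (subtopology X E) x \<in> G \<longrightarrow> p0 X \<epsilon> x \<in> S \<inter> T)"
    if a: "a \<in> topspace (end_space X \<epsilon>)" and aST: "in0 X \<epsilon> a \<in> S \<inter> T" for a
  proof -
    obtain E G where E: "E \<in> \<epsilon>" "openin (pi0 (subtopology X E)) G" "a E \<in> G"
        "\<forall>b \<in> topspace (end_space X \<epsilon>). b E \<in> G \<longrightarrow> in0 X \<epsilon> b \<in> S"
        "\<forall>x\<in>E. q0 (subtopology X E) x \<in> G \<longrightarrow> p0 X \<epsilon> x \<in> S"
      using S a aST unfolding completion_open_def by blast
    obtain F H where F: "F \<in> \<epsilon>" "openin (pi0 (subtopology X F)) H" "a F \<in> H"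
        "\<forall>b \<in> topspace (end_space X \<epsilon>). b F \<in> H \<longrightarrow> in0 X \<epsilon> b \<in> T"
        "\<forall>x\<in>F. q0 (subtopology X F) x \<in> H \<longrightarrow> p0 X \<epsilon> x \<in> T"
      using T a aST unfolding completion_open_def by blast
    let ?D = "E \<inter> F"
    have D: "?D \<in> \<epsilon>" using assms E(1) F(1) unfolding exterior_space_def by blast
    define K where "K = {C \<in> path_components_of (subtopology X ?D). pi0_incl (subtopology X E) C \<in> G}
        \<inter> {C \<in> path_components_of (subtopology X ?D). pi0_incl (subtopology X F) C \<in> H}"
    have K: "openin (pi0 (subtopology X ?D)) K"
      unfolding K_def using E(2) F(2) by (intro openin_Int openin_pi0_vimage) simp_all
    have bond: "pi0_incl (subtopology X E) (b ?D) = b E \<and> pi0_incl (subtopology X F) (b ?D) = b F \<and>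
        b ?D \<in> path_components_of (subtopology X ?D)"
      if "b \<in> topspace (end_space X \<epsilon>)" for b
      using that D E(1) F(1) by (auto simp: topspace_end_space PiE_iff)
    have sub: "?D \<subseteq> topspace X"
      using D assms unfolding exterior_space_def by (intro openin_subset) simp
    have "\<forall>x\<in>?D. q0 (subtopology X ?D) x \<in> K \<longrightarrow> p0 X \<epsilon> x \<in> S \<inter> T"
    proof (intro ballI impI)
      fix x assume x: "x \<in> ?D" "q0 (subtopology X ?D) x \<in> K"
      then have xD: "x \<in> topspace (subtopology X ?D)" using sub by auto
      have "q0 (subtopology X E) x \<in> G" "q0 (subtopology X F) x \<in> H"
        using x(2) pi0_incl_q0[OF Int_lower1 xD] pi0_incl_q0[OF Int_lower2 xD] by (simp_all add: K_def)
      moreover have "x \<in> E" "x \<in> F" using x(1) by auto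
      ultimately show "p0 X \<epsilon> x \<in> S \<inter> T" using E(5) F(5) by simp
    qed
    moreover have "a ?D \<in> K" using bond[OF a] E(3) F(3) by (simp add: K_def)
    moreover have "\<forall>b \<in> topspace (end_space X \<epsilon>). b ?D \<in> K \<longrightarrow> in0 X \<epsilon> b \<in> S \<inter> T"
    proof (intro ballI impI)
      fix b assume b: "b \<in> topspace (end_space X \<epsilon>)" "b ?D \<in> K"
      then have "b E \<in> G" "b F \<in> H" using bond[OF b(1)] by (simp_all add: K_def)
      then show "in0 X \<epsilon> b \<in> S \<inter> T" using b(1) E(4) F(4) by simp
    qed
    ultimately show ?thesis using D K by (intro bexI[of _ ?D] exI[of _ K]) simp_all
  qed
  moreover have "{x \<in> topspace X. p0 X \<epsilon> x \<in> S \<inter> T}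
      = {x \<in> topspace X. p0 X \<epsilon> x \<in> S} \<inter> {x \<in> topspace X. p0 X \<epsilon> x \<in> T}" by blast
  moreover have "{a \<in> topspace (end_space X \<epsilon>). in0 X \<epsilon> a \<in> S \<inter> T}
      = {a \<in> topspace (end_space X \<epsilon>). in0 X \<epsilon> a \<in> S} \<inter> {a \<in> topspace (end_space X \<epsilon>). in0 X \<epsilon> a \<in> T}"
    by blast
  ultimately show "completion_open X \<epsilon> (S \<inter> T)"
    using S T unfolding completion_open_def by (simp add: openin_Int le_infI1)
next
  fix \<K> assume K: "\<forall>K\<in>\<K>. completion_open X \<epsilon> K"
  have "{x \<in> topspace X. p0 X \<epsilon> x \<in> \<Union>\<K>} = (\<Union>K\<in>\<K>. {x \<in> topspace X. p0 X \<epsilon> x \<in> K})" by blast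
  then have 1: "openin X {x \<in> topspace X. p0 X \<epsilon> x \<in> \<Union>\<K>}"
    using K by (auto simp: completion_open_def)
  have "{a \<in> topspace (end_space X \<epsilon>). in0 X \<epsilon> a \<in> \<Union>\<K>}
      = (\<Union>K\<in>\<K>. {a \<in> topspace (end_space X \<epsilon>). in0 X \<epsilon> a \<in> K})" by blast
  then have 2: "openin (end_space X \<epsilon>) {a \<in> topspace (end_space X \<epsilon>). in0 X \<epsilon> a \<in> \<Union>\<K>}"
    using K by (auto simp: completion_open_def)
  have 3: "\<exists>E\<in>\<epsilon>. \<exists>G. openin (pi0 (subtopology X E)) G \<and> a E \<in> G \<and>
           (\<forall>b \<in> topspace (end_space X \<epsilon>). b E \<in> G \<longrightarrow> in0 X \<epsilon> b \<in> \<Union>\<K>) \<and>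
           (\<forall>x\<in>E. q0 (subtopology X E) x \<in> G \<longrightarrow> p0 X \<epsilon> x \<in> \<Union>\<K>)"
    if a: "a \<in> topspace (end_space X \<epsilon>)" and aK: "in0 X \<epsilon> a \<in> \<Union>\<K>" for a
  proof -
    from aK obtain M where M: "M \<in> \<K>" "in0 X \<epsilon> a \<in> M" by blast
    have "completion_open X \<epsilon> M" using K M(1) by blast
    then obtain E G where EG: "E \<in> \<epsilon>" "openin (pi0 (subtopology X E)) G" "a E \<in> G"
        "\<forall>b \<in> topspace (end_space X \<epsilon>). b E \<in> G \<longrightarrow> in0 X \<epsilon> b \<in> M"
        "\<forall>x\<in>E. q0 (subtopology X E) x \<in> G \<longrightarrow> p0 X \<epsilon> x \<in> M"
      using a M(2) unfolding completion_open_def by blast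
    show ?thesis by (intro bexI[OF _ EG(1)] exI[of _ G]) (use EG(2-) M(1) in blast)
  qed
  have "\<Union>\<K> \<subseteq> completion_set X \<epsilon>" using K unfolding completion_open_def by blast
  with 1 2 3 show "completion_open X \<epsilon> (\<Union>\<K>)" unfolding completion_open_def by (intro conjI ballI impI)
qed

lemma openin_completion:
  assumes "exterior_space X \<epsilon>"
  shows "openin (exterior_completion X \<epsilon>) W \<longleftrightarrow> completion_open X \<epsilon> W"
  by (simp add: exterior_completion_def istopology_completion[OF assms])

lemma topspace_completion:
  assumes "exterior_space X \<epsilon>"
  shows "topspace (exterior_completion X \<epsilon>) = completion_set X \<epsilon>"
proof
  show "topspace (exterior_completion X \<epsilon>) \<subseteq> completion_set X \<epsilon>"
    using openin_completion[OF assms, of "topspace (exterior_completion X \<epsilon>)"]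
    by (simp add: completion_open_def)
  obtain E where E: "E \<in> \<epsilon>" "openin X E" using assms by (auto simp: exterior_space_def)
  have p: "p0 X \<epsilon> x \<in> completion_set X \<epsilon>" if "x \<in> topspace X" for x
    using that by (auto simp: completion_set_eq)
  have i: "in0 X \<epsilon> a \<in> completion_set X \<epsilon>" if "a \<in> topspace (end_space X \<epsilon>)" for a
    using that by (auto simp: completion_set_eq)
  have G: "openin (pi0 (subtopology X E)) (path_components_of (subtopology X E))"
    by (metis openin_topspace topspace_pi0)
  have aE: "a E \<in> path_components_of (subtopology X E)" if "a \<in> topspace (end_space X \<epsilon>)" for a
    using that E(1) by (auto simp: topspace_end_space PiE_iff)
  have "{x \<in> topspace X. p0 X \<epsilon> x \<in> completion_set X \<epsilon>} = topspace X"
    using p by blast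
  moreover have "{a \<in> topspace (end_space X \<epsilon>). in0 X \<epsilon> a \<in> completion_set X \<epsilon>}
      = topspace (end_space X \<epsilon>)" using i by blast
  moreover have "\<forall>x\<in>E. p0 X \<epsilon> x \<in> completion_set X \<epsilon>"
    using p openin_subset[OF E(2)] by blast
  ultimately have "completion_open X \<epsilon> (completion_set X \<epsilon>)"
    unfolding completion_open_def
    using i aE
    by (auto intro!: bexI[OF _ E(1)] exI[of _ "path_components_of (subtopology X E)"] G)
  then show "completion_set X \<epsilon> \<subseteq> topspace (exterior_completion X \<epsilon>)"
    using openin_completion[OF assms] openin_subset by blast
qed

end

theory Submission
  imports Defs
begin

text \<open>
  Every end \<open>a\<close> has, for each exterior open set \<open>E\<close>, the basic neighbourhood consisting of the
  path-component \<open>a E\<close> of \<open>E\<close> together with all ends passing through it. Different ends are separated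
  by two such neighbourhoods over an \<open>E\<close> at which they differ; a point \<open>x\<close> outside the limit space
  is separated from all ends at once by an exterior open set missing a neighbourhood of \<open>x\<close>; and two
  points outside the limit space are separated in \<open>X\<close>, the limit space being closed.

  Compactness rests on a finiteness property (\<open>finite_path_components_meeting_exterior\<close>). An
  exterior open set \<open>E\<close> may have infinitely many path-components, but it contains an exterior
  open set \<open>E'\<close> that meets only finitely many of them. Indeed the compact set \<open>X - E\<close> lies in the
  interior of a set \<open>K\<close> that is again compact with exterior complement, and as \<open>X\<close> is connected, a
  path-component of \<open>E\<close> that leaves \<open>K\<close> must cross the frontier of \<open>K\<close>; this frontier is a compact
  subset of \<open>E\<close>, whose path-components are open.

  Suppose now that an open cover of the completion has no finite subcover, and take an
  ultrafilter none of whose members belongs to the cover. Away from \<open>E'\<close> the space is compact,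
  hence finitely covered, so the ultrafilter contains the basic set of one of the finitely many
  path-components \<open>C\<close> of \<open>E\<close> that meet \<open>E'\<close>. These choices of \<open>C\<close> for varying \<open>E\<close> are compatible,
  because members of an ultrafilter intersect. They therefore form an end, to which the
  ultrafilter converges; so it contains a member of the cover after all.
\<close>

section \<open>The completion as a set\<close>

text \<open>
  For the push-out of an inclusion the equivalence classes have normal forms: an element of the
  first summand that is glued goes to its image in the second.
\<close>

definition pushout_nf :: "'a set \<Rightarrow> ('a \<Rightarrow> 'b) \<Rightarrow> 'a + 'b \<Rightarrow> 'a + 'b" where
  "pushout_nf Z g = case_sum (\<lambda>x. if x \<in> Z then Inr (g x) else Inl x) Inr"

lemma pushout_nf_simps [simp]:
  "pushout_nf Z g (Inl x) = (if x \<in> Z then Inr (g x) else Inl x)"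
  "pushout_nf Z g (Inr y) = Inr y"
  by (simp_all add: pushout_nf_def)

lemma pushout_rel_inclusion_iff:
  "(s, t) \<in> pushout_rel Z (\<lambda>x. x) g \<longleftrightarrow> pushout_nf Z g s = pushout_nf Z g t"
proof -
  let ?r = "\<lambda>s t. \<exists>z\<in>Z. s = Inl z \<and> t = Inr (g z)"
  have to_nf: "equivclp ?r s (pushout_nf Z g s)" for s
  proof (cases s)
    case (Inl x)
    then show ?thesis by (cases "x \<in> Z") (auto intro: r_into_equivclp)
  qed simp
  have glued: "pushout_nf Z g u = pushout_nf Z g v" if "?r u v" for u v
    using that by auto
  have "pushout_nf Z g s = pushout_nf Z g t" if "equivclp ?r s t"
    using that
  proof (induction rule: equivclp_induct)
    case (step y z)
    then show ?case using glued[of y z] glued[of z y] by metis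
  qed simp
  moreover have "equivclp ?r s t" if "pushout_nf Z g s = pushout_nf Z g t"
    by (rule equivclp_trans[OF to_nf[of s]], unfold that, rule equivclp_sym[OF to_nf])
  ultimately show ?thesis unfolding pushout_rel_def by blast
qed

lemma completion_rel_class_eq_iff:
  "completion_rel X \<epsilon> `` {s} = completion_rel X \<epsilon> `` {t} \<longleftrightarrow> (s, t) \<in> completion_rel X \<epsilon>"
proof -
  let ?nf = "pushout_nf (topspace (limit_space X \<epsilon>)) (e0 X \<epsilon>)"
  have "completion_rel X \<epsilon> `` {u} = {v. ?nf u = ?nf v}" for u
    by (auto simp: pushout_rel_inclusion_iff)
  then show ?thesis by (auto simp: pushout_rel_inclusion_iff)
qed

lemma p0_eq_p0_iff:
  "p0 X \<epsilon> x = p0 X \<epsilon> y \<longleftrightarrow>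
     x = y \<or> x \<in> topspace (limit_space X \<epsilon>) \<and> y \<in> topspace (limit_space X \<epsilon>) \<and> e0 X \<epsilon> x = e0 X \<epsilon> y"
  unfolding p0_def completion_rel_class_eq_iff pushout_rel_inclusion_iff by auto

lemma p0_eq_in0_iff:
  "p0 X \<epsilon> x = in0 X \<epsilon> a \<longleftrightarrow> x \<in> topspace (limit_space X \<epsilon>) \<and> e0 X \<epsilon> x = a"
  unfolding p0_def in0_def completion_rel_class_eq_iff pushout_rel_inclusion_iff by simp

lemma in0_eq_in0_iff: "in0 X \<epsilon> a = in0 X \<epsilon> b \<longleftrightarrow> a = b"
  unfolding in0_def completion_rel_class_eq_iff pushout_rel_inclusion_iff by simp

lemma exterior_space_openin: "exterior_space X \<epsilon> \<Longrightarrow> E \<in> \<epsilon> \<Longrightarrow> openin X E"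
  by (simp add: exterior_space_def)

lemma exterior_space_subset: "exterior_space X \<epsilon> \<Longrightarrow> E \<in> \<epsilon> \<Longrightarrow> E \<subseteq> topspace X"
  by (simp add: exterior_space_openin openin_subset)

lemma topspace_limit_space:
  assumes "exterior_space X \<epsilon>"
  shows "topspace (limit_space X \<epsilon>) = \<Inter>\<epsilon>"
proof -
  obtain E where "E \<in> \<epsilon>" using assms unfolding exterior_space_def by blast
  then show ?thesis using exterior_space_subset[OF assms] by (auto simp: limit_space_def)
qed

lemma completion_cases:
  assumes "exterior_space X \<epsilon>" and "w \<in> completion_set X \<epsilon>"
  obtains x where "x \<in> topspace X" "x \<notin> \<Inter>\<epsilon>" "w = p0 X \<epsilon> x"
    | a where "a \<in> topspace (end_space X \<epsilon>)" "w = in0 X \<epsilon> a"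
  using assms e0_in_end_space[OF assms(1)] p0_eq_in0[of _ X \<epsilon>]
  unfolding completion_set_eq topspace_limit_space[OF assms(1), symmetric] by blast


section \<open>Basic open sets of the completion\<close>

text \<open>
  The path-components of \<open>E\<close> are open, so its space of path-components is discrete.
\<close>

lemma openin_pi0_iff_subset:
  assumes "locally_path_connected_space X" and "openin X E"
  shows "openin (pi0 (subtopology X E)) G \<longleftrightarrow> G \<subseteq> path_components_of (subtopology X E)"
proof -
  have "openin (subtopology X E) {y \<in> topspace (subtopology X E). q0 (subtopology X E) y \<in> G}"
    if G: "G \<subseteq> path_components_of (subtopology X E)"
  proof -
    have lpc: "locally_path_connected_space (subtopology X E)"
      using assms locally_path_connected_space_open_subset by blast
    have "{y \<in> topspace (subtopology X E). q0 (subtopology X E) y \<in> G} =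
        \<Union>{C \<in> path_components_of (subtopology X E). C \<in> G}"
    proof (intro equalityI subsetI)
      fix y assume "y \<in> {y \<in> topspace (subtopology X E). q0 (subtopology X E) y \<in> G}"
      then show "y \<in> \<Union>{C \<in> path_components_of (subtopology X E). C \<in> G}"
        using G path_component_of_refl[of "subtopology X E" y] by blast
    next
      fix y assume "y \<in> \<Union>{C \<in> path_components_of (subtopology X E). C \<in> G}"
      then obtain x where "q0 (subtopology X E) x \<in> G" "y \<in> q0 (subtopology X E) x"
        by (auto simp: path_components_of_def)
      then show "y \<in> {y \<in> topspace (subtopology X E). q0 (subtopology X E) y \<in> G}"
        by (metis (mono_tags, lifting) mem_Collect_eq path_component_of_equiv)
    qed
    then show ?thesis
      using openin_path_components_of_locally_path_connected_space[OF lpc] by auto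
  qed
  then show ?thesis by (auto simp: openin_pi0)
qed

text \<open>
  These are the sets that the second clause in the definition of the topology of the completion
  requires around each end. They absorb no glued points by accident: a point of the limit space
  lies in every exterior open set, and its end records exactly its path-components there, so
  both representatives of the point satisfy the membership condition or neither does.
\<close>

definition basic_nbhd ::
    "'a topology \<Rightarrow> 'a set set \<Rightarrow> 'a set \<Rightarrow> 'a set set \<Rightarrow> ('a + ('a set \<Rightarrow> 'a set)) set set" where
  "basic_nbhd X \<epsilon> E G =
     p0 X \<epsilon> ` {x \<in> E. q0 (subtopology X E) x \<in> G} \<union> in0 X \<epsilon> ` {a \<in> topspace (end_space X \<epsilon>). a E \<in> G}"

lemma p0_in_basic_nbhd_iff:
  assumes "exterior_space X \<epsilon>" and "E \<in> \<epsilon>"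
  shows "p0 X \<epsilon> x \<in> basic_nbhd X \<epsilon> E G \<longleftrightarrow> x \<in> E \<and> q0 (subtopology X E) x \<in> G"
proof
  have e0E: "e0 X \<epsilon> z E = q0 (subtopology X E) z" for z
    using assms(2) by (simp add: e0_def)
  have L: "topspace (limit_space X \<epsilon>) \<subseteq> E"
    using assms topspace_limit_space[OF assms(1)] by auto
  assume "p0 X \<epsilon> x \<in> basic_nbhd X \<epsilon> E G"
  then consider y where "p0 X \<epsilon> x = p0 X \<epsilon> y" "y \<in> E" "q0 (subtopology X E) y \<in> G"
    | a where "p0 X \<epsilon> x = in0 X \<epsilon> a" "a E \<in> G"
    unfolding basic_nbhd_def by auto
  then show "x \<in> E \<and> q0 (subtopology X E) x \<in> G"
    by cases (use L e0E in \<open>metis p0_eq_p0_iff subsetD\<close>, use L e0E in \<open>metis p0_eq_in0_iff subsetD\<close>)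
qed (auto simp: basic_nbhd_def)

lemma in0_in_basic_nbhd_iff:
  assumes "exterior_space X \<epsilon>" and "E \<in> \<epsilon>" and "a \<in> topspace (end_space X \<epsilon>)"
  shows "in0 X \<epsilon> a \<in> basic_nbhd X \<epsilon> E G \<longleftrightarrow> a E \<in> G"
proof
  assume "in0 X \<epsilon> a \<in> basic_nbhd X \<epsilon> E G"
  then consider y where "in0 X \<epsilon> a = p0 X \<epsilon> y" "y \<in> E" "q0 (subtopology X E) y \<in> G"
    | b where "in0 X \<epsilon> a = in0 X \<epsilon> b" "b E \<in> G"
    unfolding basic_nbhd_def by auto
  then show "a E \<in> G"
  proof cases
    case 1
    then have "a = e0 X \<epsilon> y" by (metis p0_eq_in0_iff)
    then show ?thesis using 1 assms(2) by (simp add: e0_def)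
  qed (simp add: in0_eq_in0_iff)
qed (use assms in \<open>auto simp: basic_nbhd_def\<close>)

lemma basic_nbhd_subset_completion_set:
  assumes "exterior_space X \<epsilon>" and "E \<in> \<epsilon>"
  shows "basic_nbhd X \<epsilon> E G \<subseteq> completion_set X \<epsilon>"
  using exterior_space_subset[OF assms] unfolding basic_nbhd_def completion_set_eq by blast

lemma openin_basic_nbhd:
  assumes ext: "exterior_space X \<epsilon>" and E: "E \<in> \<epsilon>" and G: "openin (pi0 (subtopology X E)) G"
  shows "openin (exterior_completion X \<epsilon>) (basic_nbhd X \<epsilon> E G)"
proof -
  let ?W = "basic_nbhd X \<epsilon> E G"
  have opE: "openin X E" by (rule exterior_space_openin[OF ext E])
  have "openin (subtopology X E) {y \<in> topspace (subtopology X E). q0 (subtopology X E) y \<in> G}"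
    using G by (simp add: openin_pi0)
  then have "openin X {y \<in> topspace (subtopology X E). q0 (subtopology X E) y \<in> G}"
    by (rule openin_trans_full[OF _ opE])
  moreover have "{y \<in> topspace (subtopology X E). q0 (subtopology X E) y \<in> G} =
      {x \<in> topspace X. p0 X \<epsilon> x \<in> ?W}"
    using openin_subset[OF opE] p0_in_basic_nbhd_iff[OF ext E] by auto
  ultimately have 1: "openin X {x \<in> topspace X. p0 X \<epsilon> x \<in> ?W}" by simp
  have "continuous_map (end_space X \<epsilon>) (pi0 (subtopology X E)) (\<lambda>a. a E)"
    unfolding end_space_def
    by (intro continuous_map_from_subtopology continuous_map_product_projection E)
  then have "openin (end_space X \<epsilon>) {a \<in> topspace (end_space X \<epsilon>). a E \<in> G}"
    by (rule openin_continuous_map_preimage[OF _ G])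
  moreover have "{a \<in> topspace (end_space X \<epsilon>). a E \<in> G} =
      {a \<in> topspace (end_space X \<epsilon>). in0 X \<epsilon> a \<in> ?W}"
    using in0_in_basic_nbhd_iff[OF ext E] by blast
  ultimately have 2: "openin (end_space X \<epsilon>) {a \<in> topspace (end_space X \<epsilon>). in0 X \<epsilon> a \<in> ?W}"
    by simp
  have "completion_open X \<epsilon> ?W"
    unfolding completion_open_def
  proof (intro conjI ballI impI)
    fix a assume a: "a \<in> topspace (end_space X \<epsilon>)" "in0 X \<epsilon> a \<in> ?W"
    show "\<exists>E\<in>\<epsilon>. \<exists>G. openin (pi0 (subtopology X E)) G \<and> a E \<in> G \<and>
           (\<forall>b \<in> topspace (end_space X \<epsilon>). b E \<in> G \<longrightarrow> in0 X \<epsilon> b \<in> ?W) \<and>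
           (\<forall>x\<in>E. q0 (subtopology X E) x \<in> G \<longrightarrow> p0 X \<epsilon> x \<in> ?W)"
      by (rule bexI[OF _ E], rule exI[of _ G])
        (use a G in \<open>simp add: in0_in_basic_nbhd_iff[OF ext E] p0_in_basic_nbhd_iff[OF ext E]\<close>)
  qed (use 1 2 basic_nbhd_subset_completion_set[OF ext E] in simp_all)
  then show ?thesis by (simp add: openin_completion[OF ext])
qed

lemma basic_nbhd_disjoint:
  assumes ext: "exterior_space X \<epsilon>" and E: "E \<in> \<epsilon>" and "G \<inter> H = {}"
  shows "basic_nbhd X \<epsilon> E G \<inter> basic_nbhd X \<epsilon> E H = {}"
proof -
  have "w \<notin> basic_nbhd X \<epsilon> E H" if w: "w \<in> basic_nbhd X \<epsilon> E G" for w
  proof -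
    from w consider x where "w = p0 X \<epsilon> x" | a where "a \<in> topspace (end_space X \<epsilon>)" "w = in0 X \<epsilon> a"
      unfolding basic_nbhd_def by blast
    then show ?thesis
      using w assms(3) p0_in_basic_nbhd_iff[OF ext E] in0_in_basic_nbhd_iff[OF ext E]
      by cases blast+
  qed
  then show ?thesis by blast
qed

text \<open>
  Outside the limit space nothing is glued, and the image contains no end, so that the clauses of
  the topology of the completion that speak of ends hold trivially.
\<close>

lemma openin_p0_image:
  assumes ext: "exterior_space X \<epsilon>" and U: "openin X U" "U \<inter> \<Inter>\<epsilon> = {}"
  shows "openin (exterior_completion X \<epsilon>) (p0 X \<epsilon> ` U)"
proof -
  have "U \<subseteq> topspace X" using U(1) openin_subset by blast
  then have "{x \<in> topspace X. p0 X \<epsilon> x \<in> p0 X \<epsilon> ` U} = U"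
    using U(2) by (auto simp: image_iff p0_eq_p0_iff topspace_limit_space[OF ext])
  moreover have "in0 X \<epsilon> a \<notin> p0 X \<epsilon> ` U" for a
    using U(2) p0_eq_in0_iff[of X \<epsilon> _ a] topspace_limit_space[OF ext] by (metis disjoint_iff imageE)
  moreover have "p0 X \<epsilon> ` U \<subseteq> completion_set X \<epsilon>"
    using \<open>U \<subseteq> topspace X\<close> by (auto simp: completion_set_eq)
  ultimately show ?thesis
    using U(1) by (simp add: openin_completion[OF ext] completion_open_def)
qed

lemma continuous_map_p0:
  assumes ext: "exterior_space X \<epsilon>"
  shows "continuous_map X (exterior_completion X \<epsilon>) (p0 X \<epsilon>)"
  unfolding continuous_map_def
  by (auto simp: topspace_completion[OF ext] completion_set_eq openin_completion[OF ext]
      completion_open_def)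


section \<open>The Hausdorff property\<close>

lemma closedin_limit_space:
  assumes ext: "exterior_space X \<epsilon>"
    and nbhd: "\<And>x. x \<in> topspace X - \<Inter>\<epsilon> \<Longrightarrow>
           \<exists>F. closedin X F \<and> x \<in> X interior_of F \<and> topspace X - F \<in> \<epsilon>"
  shows "closedin X (\<Inter>\<epsilon>)"
proof -
  have "\<exists>T. openin X T \<and> x \<in> T \<and> T \<subseteq> topspace X - \<Inter>\<epsilon>" if x: "x \<in> topspace X - \<Inter>\<epsilon>" for x
  proof -
    obtain F where F: "x \<in> X interior_of F" "topspace X - F \<in> \<epsilon>" using nbhd[OF x] by blast
    then have "X interior_of F \<subseteq> topspace X - \<Inter>\<epsilon>"
      using interior_of_subset[of X F] interior_of_subset_topspace[of X F] by blast
    then show ?thesis using F(1) by (intro exI[of _ "X interior_of F"]) simp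
  qed
  then have "openin X (topspace X - \<Inter>\<epsilon>)" by (subst openin_subopen) blast
  moreover have "\<Inter>\<epsilon> \<subseteq> topspace X"
    using topspace_limit_space[OF ext] unfolding limit_space_def by auto
  ultimately show ?thesis by (simp add: closedin_def)
qed

lemma Hausdorff_space_exterior_completion:
  assumes ext: "exterior_space X \<epsilon>" and lpc: "locally_path_connected_space X"
    and haus: "Hausdorff_space X"
    and nbhd: "\<And>x. x \<in> topspace X - \<Inter>\<epsilon> \<Longrightarrow>
           \<exists>F. closedin X F \<and> x \<in> X interior_of F \<and> topspace X - F \<in> \<epsilon>"
  shows "Hausdorff_space (exterior_completion X \<epsilon>)"
proof -
  let ?Y = "exterior_completion X \<epsilon>"
  let ?sep = "\<lambda>w v. \<exists>U V. openin ?Y U \<and> openin ?Y V \<and> w \<in> U \<and> v \<in> V \<and> disjnt U V"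
  have sepI: "?sep w v"
    if "openin ?Y U" "openin ?Y V" "disjnt U V" "w \<in> U" "v \<in> V" for w v U V
    using that by blast
  have sym: "?sep w v" if "?sep v w" for v w
    using that by (metis disjnt_sym)
  have point_point: "?sep (p0 X \<epsilon> x) (p0 X \<epsilon> y)"
    if x: "x \<in> topspace X" "x \<notin> \<Inter>\<epsilon>" and y: "y \<in> topspace X" "y \<notin> \<Inter>\<epsilon>" and "x \<noteq> y" for x y
  proof -
    obtain U V where UV: "openin X U" "openin X V" "x \<in> U" "y \<in> V" "disjnt U V"
      using haus x(1) y(1) \<open>x \<noteq> y\<close> unfolding Hausdorff_space_def by blast
    let ?U = "U - \<Inter>\<epsilon>" and ?V = "V - \<Inter>\<epsilon>"
    have "openin X ?U" "openin X ?V"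
      using UV closedin_limit_space[OF ext nbhd] by (auto intro: openin_diff)
    then have "openin ?Y (p0 X \<epsilon> ` ?U)" "openin ?Y (p0 X \<epsilon> ` ?V)"
      by (auto intro!: openin_p0_image[OF ext])
    moreover have "disjnt (p0 X \<epsilon> ` ?U) (p0 X \<epsilon> ` ?V)"
      using UV(5) by (auto simp: disjnt_iff p0_eq_p0_iff topspace_limit_space[OF ext])
    moreover have "p0 X \<epsilon> x \<in> p0 X \<epsilon> ` ?U" "p0 X \<epsilon> y \<in> p0 X \<epsilon> ` ?V"
      using x(2) y(2) UV(3,4) by blast+
    ultimately show ?thesis by (rule sepI)
  qed
  have point_limit: "?sep (p0 X \<epsilon> x) (in0 X \<epsilon> a)"
    if x: "x \<in> topspace X" "x \<notin> \<Inter>\<epsilon>" and a: "a \<in> topspace (end_space X \<epsilon>)" for x a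
  proof -
    obtain F where F: "x \<in> X interior_of F" "topspace X - F \<in> \<epsilon>" using nbhd[of x] x by blast
    let ?E = "topspace X - F" and ?U = "X interior_of F"
    let ?W = "basic_nbhd X \<epsilon> ?E (path_components_of (subtopology X ?E))"
    have disj: "?U \<inter> ?E = {}" using interior_of_subset[of X F] by blast
    have "openin ?Y (p0 X \<epsilon> ` ?U)"
      using disj F(2) by (intro openin_p0_image[OF ext]) auto
    moreover have "openin ?Y ?W"
      using openin_basic_nbhd[OF ext F(2)] by (metis openin_topspace topspace_pi0)
    moreover have "disjnt (p0 X \<epsilon> ` ?U) ?W"
      using disj by (auto simp: disjnt_iff p0_in_basic_nbhd_iff[OF ext F(2)])
    moreover have "p0 X \<epsilon> x \<in> p0 X \<epsilon> ` ?U" using F(1) by blast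
    moreover have "in0 X \<epsilon> a \<in> ?W"
      using a F(2) by (auto simp: in0_in_basic_nbhd_iff[OF ext F(2)] topspace_end_space PiE_iff)
    ultimately show ?thesis by (rule sepI)
  qed
  have limit_limit: "?sep (in0 X \<epsilon> a) (in0 X \<epsilon> b)"
    if a: "a \<in> topspace (end_space X \<epsilon>)" and b: "b \<in> topspace (end_space X \<epsilon>)" and "a \<noteq> b" for a b
  proof -
    have "a \<in> PiE \<epsilon> (\<lambda>E. path_components_of (subtopology X E))"
        "b \<in> PiE \<epsilon> (\<lambda>E. path_components_of (subtopology X E))"
      using a b by (simp_all add: topspace_end_space)
    then obtain E where E: "E \<in> \<epsilon>" "a E \<noteq> b E"
      using PiE_ext[of a \<epsilon> _ b] \<open>a \<noteq> b\<close> by metis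
    have opE: "openin X E" by (rule exterior_space_openin[OF ext E(1)])
    have "a E \<in> path_components_of (subtopology X E)" "b E \<in> path_components_of (subtopology X E)"
      using a b E(1) by (auto simp: topspace_end_space PiE_iff)
    then have "openin ?Y (basic_nbhd X \<epsilon> E {a E})" "openin ?Y (basic_nbhd X \<epsilon> E {b E})"
      by (auto intro!: openin_basic_nbhd[OF ext E(1)] simp: openin_pi0_iff_subset[OF lpc opE])
    moreover have "disjnt (basic_nbhd X \<epsilon> E {a E}) (basic_nbhd X \<epsilon> E {b E})"
      using basic_nbhd_disjoint[OF ext E(1)] E(2) by (auto simp: disjnt_def)
    moreover have "in0 X \<epsilon> a \<in> basic_nbhd X \<epsilon> E {a E}" "in0 X \<epsilon> b \<in> basic_nbhd X \<epsilon> E {b E}"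
      using a b by (simp_all add: in0_in_basic_nbhd_iff[OF ext E(1)])
    ultimately show ?thesis by (rule sepI)
  qed
  have "?sep w v" if w: "w \<in> completion_set X \<epsilon>" and v: "v \<in> completion_set X \<epsilon>" and "w \<noteq> v" for w v
  proof (rule completion_cases[OF ext w])
    fix x assume x: "x \<in> topspace X" "x \<notin> \<Inter>\<epsilon>" "w = p0 X \<epsilon> x"
    show ?thesis
      by (rule completion_cases[OF ext v])
        (use x \<open>w \<noteq> v\<close> point_point[of x] point_limit[of x] in metis)+
  next
    fix a assume a: "a \<in> topspace (end_space X \<epsilon>)" "w = in0 X \<epsilon> a"
    show ?thesis
      by (rule completion_cases[OF ext v])
        (use a \<open>w \<noteq> v\<close> sym[OF point_limit[of _ a]] limit_limit[of a] in metis)+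
  qed
  then show ?thesis
    unfolding Hausdorff_space_def topspace_completion[OF ext] by blast
qed


section \<open>Finitely many path-components near the ends\<close>

text \<open>
  A path-component of \<open>U\<close> that leaves \<open>K\<close> either crosses the frontier of \<open>K\<close> or stays away from a
  neighbourhood of the complement of \<open>U\<close>; in the latter case it is open and closed, hence everything.
  The frontier is compact and lies in \<open>U\<close>, so it meets only finitely many path-components.
\<close>

lemma finite_path_components_leaving:
  assumes lpc: "locally_path_connected_space X" and conn: "connected_space X"
    and U: "openin X U" and K: "topspace X - U \<subseteq> X interior_of K"
    and comp: "compactin X (X frontier_of K)"
  shows "finite {C \<in> path_components_of (subtopology X U). \<not> C \<subseteq> K}"
proof -
  let ?P = "path_components_of (subtopology X U)"
  let ?B = "X frontier_of K"
  have "locally_path_connected_space (subtopology X U)"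
    using lpc U locally_path_connected_space_open_subset by blast
  then have open_comp: "openin X C" if "C \<in> ?P" for C
    using that U openin_path_components_of_locally_path_connected_space openin_trans_full by blast
  have UP: "\<Union>?P = U"
    using U openin_subset[OF U] by (auto simp: Union_path_components_of)
  have "?B \<subseteq> U"
    using K frontier_of_subset_topspace[of X K] by (auto simp: frontier_of_def)
  then obtain \<F> where \<F>: "finite \<F>" "\<F> \<subseteq> ?P" "?B \<subseteq> \<Union>\<F>"
    using compactinD[OF comp, of ?P] open_comp UP by blast
  have "C \<in> insert (topspace X) \<F>" if C: "C \<in> ?P" "\<not> C \<subseteq> K" for C
  proof (cases "C \<inter> ?B = {}")
    case True
    have "connectedin (subtopology X U) C"
      using C(1) path_connectedin_path_components_of path_connectedin_imp_connectedin by blast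
    then have "connectedin X C" by (simp add: connectedin_subtopology)
    then have "C \<inter> K = {}"
      using True C(2) connectedin_Int_frontier_of[of X C K] by blast
    then have "topspace X - C = X interior_of K \<union> \<Union>(?P - {C})"
    proof (intro equalityI subsetI)
      fix x assume x: "x \<in> topspace X - C"
      show "x \<in> X interior_of K \<union> \<Union>(?P - {C})"
      proof (cases "x \<in> U")
        case True
        then show ?thesis using x UP by blast
      qed (use x K in blast)
    next
      fix x assume "x \<in> X interior_of K \<union> \<Union>(?P - {C})"
      then consider "x \<in> X interior_of K" | D where "D \<in> ?P" "D \<noteq> C" "x \<in> D" by blast
      then show "x \<in> topspace X - C"
      proof cases
        case 1
        then show ?thesis
          using \<open>C \<inter> K = {}\<close> interior_of_subset[of X K] interior_of_subset_topspace[of X K] by blast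
      next
        case 2
        then have "x \<notin> C" using C(1) path_components_of_overlap[of C "subtopology X U" D] by blast
        moreover have "x \<in> topspace X" using 2 openin_subset[OF open_comp] by blast
        ultimately show ?thesis by blast
      qed
    qed
    also have "openin X \<dots>"
      using open_comp by (intro openin_Un openin_Union) auto
    finally have "closedin X C"
      using openin_subset[OF open_comp[OF C(1)]] by (simp add: closedin_def)
    then have "C = {} \<or> C = topspace X"
      using conn open_comp[OF C(1)] by (auto simp: connected_space_clopen_in)
    then show ?thesis using C(2) by blast
  next
    case False
    then obtain y D where "y \<in> C" "D \<in> \<F>" "y \<in> D" using \<F>(3) by blast
    moreover from this have "D \<in> ?P" using \<F>(2) by blast
    ultimately have "C = D"
      using C(1) path_components_of_overlap[of C "subtopology X U" D] by blast
    then show ?thesis using \<open>D \<in> \<F>\<close> by blast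
  qed
  then have "{C \<in> ?P. \<not> C \<subseteq> K} \<subseteq> insert (topspace X) \<F>" by blast
  then show ?thesis using \<F>(1) finite_subset by blast
qed

text \<open>The factor \<open>topspace X\<close> makes the empty family yield the largest exterior open set.\<close>

lemma exterior_space_Inter:
  assumes ext: "exterior_space X \<epsilon>" and "finite \<F>" and "\<F> \<subseteq> \<epsilon>"
  shows "topspace X \<inter> \<Inter>\<F> \<in> \<epsilon>"
  using assms(2,3)
proof (induction \<F>)
  case empty
  show ?case
    using ext openin_subset unfolding exterior_space_def
    by (metis Int_UNIV_right Inter_empty ex_in_conv openin_topspace)
next
  case (insert E \<F>)
  then have "E \<inter> (topspace X \<inter> \<Inter>\<F>) \<in> \<epsilon>" using ext unfolding exterior_space_def by blast
  then show ?case by (simp add: Int_left_commute)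
qed

text \<open>
  No point of the compact complement of \<open>E\<close> lies in the limit space, so finitely many closed
  neighbourhoods with exterior complement have interiors covering it. Their union serves as the set
  \<open>K\<close> of \<open>finite_path_components_leaving\<close>, and \<open>E'\<close> is its complement.
\<close>

lemma finite_path_components_meeting_exterior:
  assumes ext: "exterior_space X \<epsilon>" and lpc: "locally_path_connected_space X"
    and conn: "connected_space X" and coc: "\<epsilon> \<subseteq> cocompact_externology X"
    and nbhd: "\<And>x. x \<in> topspace X - \<Inter>\<epsilon> \<Longrightarrow>
           \<exists>F. closedin X F \<and> x \<in> X interior_of F \<and> topspace X - F \<in> \<epsilon>"
    and E: "E \<in> \<epsilon>"
  obtains E' where "E' \<in> \<epsilon>" "E' \<subseteq> E" "finite {C \<in> path_components_of (subtopology X E). C \<inter> E' \<noteq> {}}"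
proof -
  have compl: "compactin X (topspace X - D)" if "D \<in> \<epsilon>" for D
  proof -
    obtain K where "D = topspace X - K" "compactin X K"
      using coc \<open>D \<in> \<epsilon>\<close> unfolding cocompact_externology_def by auto
    moreover from this have "topspace X - D = K" using compactin_subset_topspace by fastforce
    ultimately show ?thesis by simp
  qed
  have opE: "openin X E" by (rule exterior_space_openin[OF ext E])
  have "\<exists>F. closedin X F \<and> x \<in> X interior_of F \<and> topspace X - F \<in> \<epsilon>" if "x \<in> topspace X - E" for x
    using nbhd[of x] E that by blast
  then obtain F where F: "\<And>x. x \<in> topspace X - E \<Longrightarrow>
      closedin X (F x) \<and> x \<in> X interior_of (F x) \<and> topspace X - F x \<in> \<epsilon>"
    by metis
  let ?\<U> = "(\<lambda>x. X interior_of (F x)) ` (topspace X - E)"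
  have "\<exists>\<V>. finite \<V> \<and> \<V> \<subseteq> ?\<U> \<and> topspace X - E \<subseteq> \<Union>\<V>"
    using F by (intro compactinD[OF compl[OF E]]) auto
  then obtain \<V> where \<V>: "finite \<V>" "\<V> \<subseteq> ?\<U>" "topspace X - E \<subseteq> \<Union>\<V>" by blast
  obtain S where S: "S \<subseteq> topspace X - E" "finite S" "\<V> = (\<lambda>x. X interior_of (F x)) ` S"
    using finite_subset_image[OF \<V>(1,2)] by blast
  define E' where "E' = topspace X \<inter> \<Inter>((\<lambda>x. topspace X - F x) ` S)"
  have E'\<epsilon>: "E' \<in> \<epsilon>"
    unfolding E'_def using S F by (intro exterior_space_Inter[OF ext]) auto
  have opE': "openin X E'" by (rule exterior_space_openin[OF ext E'\<epsilon>])
  let ?K = "topspace X - E'"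
  have "F x \<subseteq> ?K" if "x \<in> S" for x
    using F[of x] S(1) that closedin_subset[of X "F x"] unfolding E'_def by blast
  then have KE: "topspace X - E \<subseteq> X interior_of ?K"
    using \<V>(3) interior_of_mono[of _ ?K X] unfolding S(3) by blast
  have "X frontier_of ?K \<subseteq> ?K"
    using opE' by (intro frontier_of_subset_closedin) (simp add: closedin_diff)
  then have "compactin X (X frontier_of ?K)"
    by (rule closed_compactin[OF compl[OF E'\<epsilon>] _ closedin_frontier_of])
  then have fin: "finite {C \<in> path_components_of (subtopology X E). \<not> C \<subseteq> ?K}"
    by (rule finite_path_components_leaving[OF lpc conn opE KE])
  show thesis
  proof
    show "E' \<subseteq> E"
      using KE interior_of_subset[of X ?K] openin_subset[OF opE'] by blast
    show "finite {C \<in> path_components_of (subtopology X E). C \<inter> E' \<noteq> {}}"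
      by (rule finite_subset[OF _ fin]) blast
  qed (fact E'\<epsilon>)
qed


section \<open>Compactness\<close>

text \<open>
  By Zorn's lemma \<open>\<U>\<close> extends to a maximal family no finite part of which covers \<open>Y\<close>. The sets
  outside this family form an ultrafilter: it contains a member of every finite cover because the
  family has no finite subcover, and its members intersect because the family is maximal.
\<close>

lemma ultrafilter_avoiding_cover:
  assumes "\<nexists>\<V>. finite \<V> \<and> \<V> \<subseteq> \<U> \<and> Y \<subseteq> \<Union>\<V>"
  obtains \<F> where "\<U> \<inter> \<F> = {}"
    and "\<forall>\<C>. finite \<C> \<longrightarrow> Y \<subseteq> \<Union>\<C> \<longrightarrow> \<C> \<inter> \<F> \<noteq> {}"
    and "\<forall>A\<in>\<F>. \<forall>B\<in>\<F>. Y \<inter> A \<inter> B \<noteq> {}"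
proof -
  let ?nc = "\<lambda>\<I>. \<nexists>\<V>. finite \<V> \<and> \<V> \<subseteq> \<I> \<and> Y \<subseteq> \<Union>\<V>"
  let ?A = "{\<I>. \<U> \<subseteq> \<I> \<and> ?nc \<I>}"
  have "\<exists>M\<in>?A. \<forall>\<I>\<in>?A. M \<subseteq> \<I> \<longrightarrow> \<I> = M"
  proof (rule subset_Zorn_nonempty)
    show "?A \<noteq> {}" using assms by blast
    fix \<C> assume \<C>: "\<C> \<noteq> {}" "subset.chain ?A \<C>"
    then have sub: "\<C> \<subseteq> ?A" by (auto simp: subset_chain_def)
    have "?nc (\<Union>\<C>)"
    proof
      assume "\<exists>\<V>. finite \<V> \<and> \<V> \<subseteq> \<Union>\<C> \<and> Y \<subseteq> \<Union>\<V>"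
      then obtain \<V> where \<V>: "finite \<V>" "\<V> \<subseteq> \<Union>\<C>" "Y \<subseteq> \<Union>\<V>" by blast
      obtain \<I> where "\<I> \<in> \<C>" "\<V> \<subseteq> \<I>"
        by (rule finite_subset_Union_chain[OF \<V>(1,2) \<C>])
      then show False using \<V> sub by blast
    qed
    then show "\<Union>\<C> \<in> ?A" using \<C>(1) sub by blast
  qed
  then obtain \<I> where \<I>: "\<U> \<subseteq> \<I>" "?nc \<I>" and max: "\<And>\<J>. \<U> \<subseteq> \<J> \<Longrightarrow> ?nc \<J> \<Longrightarrow> \<I> \<subseteq> \<J> \<Longrightarrow> \<J> = \<I>"
    by auto
  have finite_rest: "\<exists>\<V>. finite \<V> \<and> \<V> \<subseteq> \<I> \<and> Y - A \<subseteq> \<Union>\<V>" if "A \<notin> \<I>" for A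
  proof -
    have "insert A \<I> \<noteq> \<I>" using that by auto
    then have "\<not> ?nc (insert A \<I>)"
      using max[OF subset_insertI2[OF \<I>(1)] _ subset_insertI] by metis
    then obtain \<V> where "finite \<V>" "\<V> \<subseteq> insert A \<I>" "Y \<subseteq> \<Union>\<V>" by blast
    then show ?thesis by (intro exI[of _ "\<V> - {A}"]) auto
  qed
  show thesis
  proof
    show "\<U> \<inter> - \<I> = {}" using \<I>(1) by blast
    show "\<forall>\<C>. finite \<C> \<longrightarrow> Y \<subseteq> \<Union>\<C> \<longrightarrow> \<C> \<inter> - \<I> \<noteq> {}"
      using \<I>(2) by blast
    have "Y \<inter> A \<inter> B \<noteq> {}" if A: "A \<notin> \<I>" and B: "B \<notin> \<I>" for A B
    proof
      assume empty: "Y \<inter> A \<inter> B = {}"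
      obtain \<V> where \<V>: "finite \<V>" "\<V> \<subseteq> \<I>" "Y - A \<subseteq> \<Union>\<V>"
        using finite_rest[OF A] by blast
      obtain \<W> where \<W>: "finite \<W>" "\<W> \<subseteq> \<I>" "Y - B \<subseteq> \<Union>\<W>"
        using finite_rest[OF B] by blast
      have "finite (\<V> \<union> \<W>)" "\<V> \<union> \<W> \<subseteq> \<I>" using \<V> \<W> by simp_all
      moreover have "Y \<subseteq> \<Union>(\<V> \<union> \<W>)" using \<V>(3) \<W>(3) empty by blast
      ultimately show False using \<I>(2) by blast
    qed
    then show "\<forall>A\<in>- \<I>. \<forall>B\<in>- \<I>. Y \<inter> A \<inter> B \<noteq> {}" by blast
  qed
qed

lemma subset_pi0_incl:
  assumes "A \<subseteq> B" and "C \<in> path_components_of (subtopology X A)"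
  shows "pi0_incl (subtopology X B) C \<in> path_components_of (subtopology X B)"
    and "C \<subseteq> pi0_incl (subtopology X B) C"
proof -
  obtain x where x: "x \<in> topspace (subtopology X A)" "C = q0 (subtopology X A) x"
    using assms(2) unfolding path_components_of_def by blast
  have eq: "pi0_incl (subtopology X B) C = q0 (subtopology X B) x"
    using pi0_incl_q0[OF assms(1) x(1)] x(2) by simp
  have "x \<in> topspace (subtopology X B)" using x(1) assms(1) by auto
  then show "pi0_incl (subtopology X B) C \<in> path_components_of (subtopology X B)"
    by (simp add: eq path_component_in_path_components_of)
  have "C \<subseteq> q0 (subtopology X B) x"
    unfolding x(2) using path_component_of_mono[OF _ assms(1)] by blast
  then show "C \<subseteq> pi0_incl (subtopology X B) C" by (simp only: eq)
qed

text \<open>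
  The basic sets over the finitely many path-components that an exterior open subset \<open>E'\<close> of \<open>E\<close>
  meets exhaust the neighbourhood of the ends given by \<open>E'\<close>: an end passes through \<open>E'\<close>, so its
  path-component in \<open>E\<close> meets \<open>E'\<close>.
\<close>

lemma completion_set_subset_basic_nbhds:
  assumes ext: "exterior_space X \<epsilon>" and E: "E \<in> \<epsilon>" and E': "E' \<in> \<epsilon>" "E' \<subseteq> E"
  shows "completion_set X \<epsilon> \<subseteq> p0 X \<epsilon> ` (topspace X - E') \<union>
    (\<Union>C \<in> {C \<in> path_components_of (subtopology X E). C \<inter> E' \<noteq> {}}. basic_nbhd X \<epsilon> E {C})"
proof
  let ?R = "{C \<in> path_components_of (subtopology X E). C \<inter> E' \<noteq> {}}"
  fix w assume "w \<in> completion_set X \<epsilon>"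
  then consider x where "x \<in> topspace X" "w = p0 X \<epsilon> x"
    | a where "a \<in> topspace (end_space X \<epsilon>)" "w = in0 X \<epsilon> a"
    unfolding completion_set_eq by blast
  then show "w \<in> p0 X \<epsilon> ` (topspace X - E') \<union> (\<Union>C\<in>?R. basic_nbhd X \<epsilon> E {C})"
  proof cases
    case (1 x)
    show ?thesis
    proof (cases "x \<in> E'")
      case True
      then have x: "x \<in> topspace (subtopology X E)" using 1 E' by auto
      have "q0 (subtopology X E) x \<in> ?R"
        using x True path_component_of_refl[of "subtopology X E" x]
        by (auto simp: path_component_in_path_components_of)
      moreover have "w \<in> basic_nbhd X \<epsilon> E {q0 (subtopology X E) x}"
        using 1 True E' by (auto simp: p0_in_basic_nbhd_iff[OF ext E])
      ultimately show ?thesis by blast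
    qed (use 1 in blast)
  next
    case (2 a)
    have aE': "a E' \<in> path_components_of (subtopology X E')"
      and eq: "pi0_incl (subtopology X E) (a E') = a E"
      using 2(1) E E' by (auto simp: topspace_end_space PiE_iff)
    have "a E' \<subseteq> E'" "a E' \<noteq> {}"
      using path_components_of_subset[OF aE'] nonempty_path_components_of[OF aE'] by auto
    then have "a E \<in> ?R" using subset_pi0_incl[OF E'(2) aE'] eq by auto
    moreover have "w \<in> basic_nbhd X \<epsilon> E {a E}"
      using 2 by (simp add: in0_in_basic_nbhd_iff[OF ext E])
    ultimately show ?thesis by blast
  qed
qed

text \<open>
  Common points of basic sets force their path-components to be nested: this is the compatibility
  that turns a choice of path-components with pairwise meeting basic sets into an end.
\<close>

lemma pi0_incl_eq_if_basic_nbhds_meet: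
  assumes ext: "exterior_space X \<epsilon>" and E: "E \<in> \<epsilon>" "E' \<in> \<epsilon>" "E \<subseteq> E'"
    and w: "w \<in> completion_set X \<epsilon>" "w \<in> basic_nbhd X \<epsilon> E {C}" "w \<in> basic_nbhd X \<epsilon> E' {C'}"
  shows "pi0_incl (subtopology X E') C = C'"
proof -
  from w(1) consider x where "x \<in> topspace X" "w = p0 X \<epsilon> x"
    | a where "a \<in> topspace (end_space X \<epsilon>)" "w = in0 X \<epsilon> a"
    unfolding completion_set_eq by blast
  then show ?thesis
  proof cases
    case (1 x)
    then have "x \<in> topspace (subtopology X E)" "C = q0 (subtopology X E) x" "C' = q0 (subtopology X E') x"
      using w by (auto simp: p0_in_basic_nbhd_iff[OF ext E(1)] p0_in_basic_nbhd_iff[OF ext E(2)])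
    then show ?thesis using pi0_incl_q0[OF E(3)] by blast
  next
    case (2 a)
    then have "a E = C" "a E' = C'"
      using w by (simp_all add: in0_in_basic_nbhd_iff[OF ext E(1)] in0_in_basic_nbhd_iff[OF ext E(2)])
    then show ?thesis using 2(1) E by (auto simp: topspace_end_space)
  qed
qed

lemma compact_space_exterior_completion:
  assumes ext: "exterior_space X \<epsilon>" and coc: "\<epsilon> \<subseteq> cocompact_externology X"
    and fin: "\<And>E. E \<in> \<epsilon> \<Longrightarrow> \<exists>E'\<in>\<epsilon>. E' \<subseteq> E \<and>
           finite {C \<in> path_components_of (subtopology X E). C \<inter> E' \<noteq> {}}"
  shows "compact_space (exterior_completion X \<epsilon>)"
proof -
  let ?Y = "exterior_completion X \<epsilon>"
  let ?S = "completion_set X \<epsilon>"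
  have "\<exists>\<V>. finite \<V> \<and> \<V> \<subseteq> \<U> \<and> ?S \<subseteq> \<Union>\<V>"
    if op: "\<And>U. U \<in> \<U> \<Longrightarrow> openin ?Y U" and cover: "?S \<subseteq> \<Union>\<U>" for \<U>
  proof (rule ccontr)
    assume no: "\<nexists>\<V>. finite \<V> \<and> \<V> \<subseteq> \<U> \<and> ?S \<subseteq> \<Union>\<V>"
    obtain \<F> where avoid: "\<U> \<inter> \<F> = {}"
      and prime: "\<forall>\<C>. finite \<C> \<longrightarrow> ?S \<subseteq> \<Union>\<C> \<longrightarrow> \<C> \<inter> \<F> \<noteq> {}"
      and meet: "\<forall>A\<in>\<F>. \<forall>B\<in>\<F>. ?S \<inter> A \<inter> B \<noteq> {}"
      by (rule ultrafilter_avoiding_cover[OF no])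
    have "\<exists>C \<in> path_components_of (subtopology X E). basic_nbhd X \<epsilon> E {C} \<in> \<F>" if E: "E \<in> \<epsilon>" for E
    proof -
      obtain E' where E': "E' \<in> \<epsilon>" "E' \<subseteq> E"
        and finR: "finite {C \<in> path_components_of (subtopology X E). C \<inter> E' \<noteq> {}}"
        using fin[OF E] by blast
      let ?\<W> = "(\<lambda>C. basic_nbhd X \<epsilon> E {C}) `
        {C \<in> path_components_of (subtopology X E). C \<inter> E' \<noteq> {}}"
      obtain K where K: "compactin X K" "E' = topspace X - K"
        using coc E'(1) unfolding cocompact_externology_def by blast
      have "compactin ?Y (p0 X \<epsilon> ` K)"
        by (rule image_compactin[OF K(1) continuous_map_p0[OF ext]])
      moreover from this have "p0 X \<epsilon> ` K \<subseteq> \<Union>\<U>"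
        using cover compactin_subset_topspace[of ?Y] topspace_completion[OF ext] by blast
      ultimately have "\<exists>\<V>. finite \<V> \<and> \<V> \<subseteq> \<U> \<and> p0 X \<epsilon> ` K \<subseteq> \<Union>\<V>"
        using op by (intro compactinD)
      then obtain \<V> where \<V>: "finite \<V>" "\<V> \<subseteq> \<U>" "p0 X \<epsilon> ` K \<subseteq> \<Union>\<V>" by blast
      have "topspace X - E' \<subseteq> K" using K(2) by blast
      then have "p0 X \<epsilon> ` (topspace X - E') \<subseteq> \<Union>\<V>" using \<V>(3) by blast
      then have "?S \<subseteq> \<Union>(\<V> \<union> ?\<W>)"
        using completion_set_subset_basic_nbhds[OF ext E E'] by auto
      moreover have "finite (\<V> \<union> ?\<W>)" using \<V>(1) finR by simp
      ultimately have "(\<V> \<union> ?\<W>) \<inter> \<F> \<noteq> {}" using prime by simp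
      then obtain W where "W \<in> ?\<W>" "W \<in> \<F>" using \<V>(2) avoid by blast
      then show ?thesis by blast
    qed
    then obtain c where c: "\<And>E. E \<in> \<epsilon> \<Longrightarrow> c E \<in> path_components_of (subtopology X E)"
        "\<And>E. E \<in> \<epsilon> \<Longrightarrow> basic_nbhd X \<epsilon> E {c E} \<in> \<F>"
      by metis
    \<comment> \<open>the end to which the ultrafilter converges\<close>
    define a where "a = restrict c \<epsilon>"
    have "pi0_incl (subtopology X E') (c E) = c E'" if "E \<in> \<epsilon>" "E' \<in> \<epsilon>" "E \<subseteq> E'" for E E'
    proof -
      have "?S \<inter> basic_nbhd X \<epsilon> E {c E} \<inter> basic_nbhd X \<epsilon> E' {c E'} \<noteq> {}"
        using meet c(2) that by simp
      then show ?thesis using pi0_incl_eq_if_basic_nbhds_meet[OF ext that] by blast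
    qed
    then have a: "a \<in> topspace (end_space X \<epsilon>)"
      using c(1) by (auto simp: topspace_end_space a_def)
    then obtain U where U: "U \<in> \<U>" "in0 X \<epsilon> a \<in> U"
      using cover by (auto simp: completion_set_eq)
    then have "completion_open X \<epsilon> U" using op by (simp add: openin_completion[OF ext])
    then obtain E G where EG: "E \<in> \<epsilon>" "a E \<in> G"
        "\<forall>b \<in> topspace (end_space X \<epsilon>). b E \<in> G \<longrightarrow> in0 X \<epsilon> b \<in> U"
        "\<forall>x\<in>E. q0 (subtopology X E) x \<in> G \<longrightarrow> p0 X \<epsilon> x \<in> U"
      using a U(2) unfolding completion_open_def by blast
    have sub: "basic_nbhd X \<epsilon> E {c E} \<subseteq> U"
      using EG unfolding basic_nbhd_def a_def by auto
    have "{U, ?S - U} \<inter> \<F> \<noteq> {}" using prime[rule_format, of "{U, ?S - U}"] by auto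
    then have "?S - U \<in> \<F>" using avoid U(1) by blast
    then have "?S \<inter> basic_nbhd X \<epsilon> E {c E} \<inter> (?S - U) \<noteq> {}" using meet c(2)[OF EG(1)] by simp
    then show False using sub by blast
  qed
  then show ?thesis
    unfolding compact_space_alt topspace_completion[OF ext] by metis
qed


section \<open>The completion is a compact Hausdorff space\<close>

theorem theorem3p8:
  fixes X :: "'a topology" and \<epsilon> :: "'a set set"
  assumes "exterior_space X \<epsilon>"
    and "locally_path_connected_space X"
    and "connected_space X"
    and "Hausdorff_space X"
    and "\<epsilon> \<subseteq> cocompact_externology X"
    and "\<And>x. x \<in> topspace X - topspace (limit_space X \<epsilon>) \<Longrightarrow>
           \<exists>F. closedin X F \<and> x \<in> X interior_of F \<and> topspace X - F \<in> \<epsilon>"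
  shows "Hausdorff_space (exterior_completion X \<epsilon>) \<and> compact_space (exterior_completion X \<epsilon>) \<and>
         closedin X (topspace (limit_space X \<epsilon>))"
proof -
  note L = topspace_limit_space[OF assms(1)]
  note nbhd = assms(6)[unfolded L]
  have "\<exists>E'\<in>\<epsilon>. E' \<subseteq> E \<and> finite {C \<in> path_components_of (subtopology X E). C \<inter> E' \<noteq> {}}"
    if "E \<in> \<epsilon>" for E
    by (rule finite_path_components_meeting_exterior[OF assms(1-3,5) nbhd that]) blast+
  then show ?thesis
    using Hausdorff_space_exterior_completion[OF assms(1,2,4) nbhd]
      compact_space_exterior_completion[OF assms(1,5)] closedin_limit_space[OF assms(1) nbhd]
    by (simp add: L)
qed

end
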